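(* Let $(M^n,g)$ be a perfect fluid spacetime which admits a $k$-almost Yamabe soliton $(g,Z,k,\lambda)$, with potential vector field $Z$. Then $Z$ is a Killing vector field (that is, $\pounds_Z g=0$) if and only if $\operatorname{div} Z=0$.
   Context: $(M^n,g)$ is a Lorentzian manifold, $n\ge 3$, with metric $g$ of signature $(-,+,\ldots,+)$, Levi-Civita connection $\nabla$, Ricci tensor $S$ and scalar curvature $R$. $\pounds$ denotes the Lie derivative and $\operatorname{div}$ the divergence with respect to $g$. Perfect fluid spacetime: a Lorentzian manifold whose Ricci tensor is non-vanishing and satisfies $S=\alpha g+\beta\, C\otimes C$, where $\alpha,\beta$ are scalar functions (not simultaneously zero), $C$ is the 1-form $C(X)=g(X,\rho)$ for all vector fields $X$, and $\rho$ is the velocity vector field, which is unit timelike: $g(\rho,\rho)=-1$. $k$-almost Yamabe soliton $(g,Z,k,\lambda)$: a smooth vector field $Z$ (the potential vector field), a nowhere vanishing smooth function $k$ and a smooth function $\lambda$ on $M$ such that $\frac{k}{2}\pounds_Z g=(R-\lambda)g$. *)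

theory Defs
  imports "HOL-Analysis.Analysis"
begin

text \<open>For open S in a finite-dimensional space: a map is of class C(k+1) iff it is differentiable
  and all its directional derivatives are of class C(k).\<close>

primrec Ck_on :: "nat \<Rightarrow> ('a::real_normed_vector \<Rightarrow> 'b::real_normed_vector) \<Rightarrow> 'a set \<Rightarrow> bool" where
  "Ck_on 0 f S \<longleftrightarrow> continuous_on S f"
| "Ck_on (Suc k) f S \<longleftrightarrow>
     (\<forall>x\<in>S. f differentiable (at x)) \<and> (\<forall>v. Ck_on k (\<lambda>x. frechet_derivative f (at x) v) S)"

definition smooth_map_on :: "('a::real_normed_vector \<Rightarrow> 'b::real_normed_vector) \<Rightarrow> 'a set \<Rightarrow> bool" where
  "smooth_map_on f S \<longleftrightarrow> (\<forall>k. Ck_on k f S)"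

text \<open>A chart is a pair (U, f) of a coordinate domain U in M and a coordinate map f on U.
  The values of f outside U are irrelevant.\<close>

type_synonym ('a, 'n) chart = "'a set \<times> ('a \<Rightarrow> real ^ 'n)"

definition coord_range :: "('a, 'n::finite) chart \<Rightarrow> (real ^ 'n) set" where
  "coord_range c = snd c ` fst c"

definition chart_inv :: "('a, 'n::finite) chart \<Rightarrow> real ^ 'n \<Rightarrow> 'a" where
  "chart_inv c = inv_into (fst c) (snd c)"

definition transition :: "('a, 'n::finite) chart \<Rightarrow> ('a, 'n) chart \<Rightarrow> real ^ 'n \<Rightarrow> real ^ 'n" where
  "transition c c' = snd c' \<circ> chart_inv c"

definition overlap :: "('a, 'n::finite) chart \<Rightarrow> ('a, 'n) chart \<Rightarrow> (real ^ 'n) set" where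
  "overlap c c' = snd c ` (fst c \<inter> fst c')"

definition is_chart :: "'a topology \<Rightarrow> ('a, 'n::finite) chart \<Rightarrow> bool" where
  "is_chart M c \<longleftrightarrow> openin M (fst c) \<and> open (coord_range c) \<and>
     homeomorphic_map (subtopology M (fst c)) (top_of_set (coord_range c)) (snd c)"

text \<open>The atlas is not required to be maximal: smooth functions and smooth tensor fields given on
  an atlas extend uniquely to every compatible chart.\<close>

definition smooth_manifold :: "'a topology \<Rightarrow> ('a, 'n::finite) chart set \<Rightarrow> bool" where
  "smooth_manifold M A \<longleftrightarrow>
     Hausdorff_space M \<and> second_countable M \<and>
     (\<forall>c\<in>A. is_chart M c) \<and> (\<Union>c\<in>A. fst c) = topspace M \<and>
     (\<forall>c\<in>A. \<forall>c'\<in>A. smooth_map_on (transition c c') (overlap c c'))"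

text \<open>Tensor fields are given classically, by their components in every chart of the atlas, as
  functions of the coordinates, subject to the tensorial transformation law on overlaps.\<close>

definition smooth_function :: "('a, 'n::finite) chart set \<Rightarrow> ('a \<Rightarrow> real) \<Rightarrow> bool" where
  "smooth_function A f \<longleftrightarrow> (\<forall>c\<in>A. smooth_map_on (f \<circ> chart_inv c) (coord_range c))"

type_synonym ('a, 'n) vfield = "('a, 'n) chart \<Rightarrow> real ^ 'n \<Rightarrow> real ^ 'n"
type_synonym ('a, 'n) tensor2 = "('a, 'n) chart \<Rightarrow> real ^ 'n \<Rightarrow> real ^ 'n ^ 'n"

definition vector_field :: "('a, 'n::finite) chart set \<Rightarrow> ('a, 'n) vfield \<Rightarrow> bool" where
  "vector_field A Z \<longleftrightarrow>
     (\<forall>c\<in>A. smooth_map_on (Z c) (coord_range c)) \<and>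
     (\<forall>c\<in>A. \<forall>c'\<in>A. \<forall>x\<in>overlap c c'.
        Z c' (transition c c' x) = jacobian (transition c c') (at x) *v Z c x)"

definition covariant_2_tensor :: "('a, 'n::finite) chart set \<Rightarrow> ('a, 'n) tensor2 \<Rightarrow> bool" where
  "covariant_2_tensor A g \<longleftrightarrow>
     (\<forall>c\<in>A. smooth_map_on (g c) (coord_range c)) \<and>
     (\<forall>c\<in>A. \<forall>c'\<in>A. \<forall>x\<in>overlap c c'.
        g c x = transpose (jacobian (transition c c') (at x)) ** g c' (transition c c' x) **
                jacobian (transition c c') (at x))"

text \<open>The columns of P form an orthonormal basis of signature (-,+,...,+).\<close>

definition lorentz_form :: "real ^ 'n ^ 'n::finite \<Rightarrow> bool" where
  "lorentz_form G \<longleftrightarrow> transpose G = G \<and>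
     (\<exists>(P :: real ^ 'n ^ 'n) (i0 :: 'n). invertible P \<and>
        transpose P ** G ** P = (\<chi> i j. if i = j then (if i = i0 then - 1 else 1) else 0))"

definition lorentzian_manifold ::
  "'a topology \<Rightarrow> ('a, 'n::finite) chart set \<Rightarrow> ('a, 'n) tensor2 \<Rightarrow> bool" where
  "lorentzian_manifold M A g \<longleftrightarrow>
     smooth_manifold M A \<and> covariant_2_tensor A g \<and>
     (\<forall>c\<in>A. \<forall>x\<in>coord_range c. lorentz_form (g c x))"

text \<open>From here to \<open>christoffel_metric\<close>, G is the component matrix of the metric and X, Y, Z are
  the components of vector fields in one chart, as functions of the coordinates.\<close>

definition inner_wrt :: "real ^ 'n ^ 'n::finite \<Rightarrow> real ^ 'n \<Rightarrow> real ^ 'n \<Rightarrow> real" where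
  "inner_wrt G v w = v \<bullet> (G *v w)"

definition coord_field :: "'n::finite \<Rightarrow> real ^ 'n \<Rightarrow> real ^ 'n" where
  "coord_field i x = axis i 1"

definition pderiv_at :: "'n::finite \<Rightarrow> (real ^ 'n \<Rightarrow> real) \<Rightarrow> real ^ 'n \<Rightarrow> real" where
  "pderiv_at i f x = frechet_derivative f (at x) (axis i 1)"

definition lie_bracket ::
  "(real ^ 'n \<Rightarrow> real ^ 'n) \<Rightarrow> (real ^ 'n \<Rightarrow> real ^ 'n) \<Rightarrow> real ^ 'n \<Rightarrow> real ^ 'n::finite" where
  "lie_bracket X Y x = frechet_derivative Y (at x) (X x) - frechet_derivative X (at x) (Y x)"

text \<open>\<open>christoffel G k i j\<close> has upper index k and lower indices i, j. By
  \<open>levi_civita_torsion_free\<close> and \<open>christoffel_metric\<close> it gives the torsion-free metric connection.\<close>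

definition christoffel ::
  "(real ^ 'n \<Rightarrow> real ^ 'n ^ 'n) \<Rightarrow> 'n \<Rightarrow> 'n \<Rightarrow> 'n \<Rightarrow> real ^ 'n::finite \<Rightarrow> real" where
  "christoffel G k i j x = (\<Sum>l\<in>UNIV. matrix_inv (G x) $ k $ l *
     (pderiv_at i (\<lambda>y. G y $ j $ l) x + pderiv_at j (\<lambda>y. G y $ i $ l) x
      - pderiv_at l (\<lambda>y. G y $ i $ j) x)) / 2"

text \<open>The Levi-Civita connection: \<open>levi_civita G X Y\<close> is the derivative of Y along X.\<close>

definition levi_civita ::
  "(real ^ 'n \<Rightarrow> real ^ 'n ^ 'n) \<Rightarrow> (real ^ 'n \<Rightarrow> real ^ 'n) \<Rightarrow> (real ^ 'n \<Rightarrow> real ^ 'n) \<Rightarrow>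
   real ^ 'n \<Rightarrow> real ^ 'n::finite" where
  "levi_civita G X Y x = frechet_derivative Y (at x) (X x) +
     (\<chi> k. \<Sum>i\<in>UNIV. \<Sum>j\<in>UNIV. christoffel G k i j x * X x $ i * Y x $ j)"

definition curvature ::
  "(real ^ 'n \<Rightarrow> real ^ 'n ^ 'n) \<Rightarrow> (real ^ 'n \<Rightarrow> real ^ 'n) \<Rightarrow> (real ^ 'n \<Rightarrow> real ^ 'n) \<Rightarrow>
   (real ^ 'n \<Rightarrow> real ^ 'n) \<Rightarrow> real ^ 'n \<Rightarrow> real ^ 'n::finite" where
  "curvature G X Y Z x = levi_civita G X (levi_civita G Y Z) x
     - levi_civita G Y (levi_civita G X Z) x - levi_civita G (lie_bracket X Y) Z x"

text \<open>S(Y,Z) is the trace of X \<open>\<mapsto>\<close> curvature(X,Y)Z.\<close>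

definition ricci :: "(real ^ 'n \<Rightarrow> real ^ 'n ^ 'n) \<Rightarrow> real ^ 'n \<Rightarrow> real ^ 'n ^ 'n::finite" where
  "ricci G x = (\<chi> j k. \<Sum>i\<in>UNIV. curvature G (coord_field i) (coord_field j) (coord_field k) x $ i)"

definition scalar_curvature :: "(real ^ 'n \<Rightarrow> real ^ 'n ^ 'n) \<Rightarrow> real ^ 'n::finite \<Rightarrow> real" where
  "scalar_curvature G x = (\<Sum>j\<in>UNIV. \<Sum>k\<in>UNIV. matrix_inv (G x) $ j $ k * ricci G x $ j $ k)"

definition divergence ::
  "(real ^ 'n \<Rightarrow> real ^ 'n ^ 'n) \<Rightarrow> (real ^ 'n \<Rightarrow> real ^ 'n) \<Rightarrow> real ^ 'n::finite \<Rightarrow> real" where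
  "divergence G Z x = (\<Sum>i\<in>UNIV. levi_civita G (coord_field i) Z x $ i)"

text \<open>Z(g(X,Y)) - g([Z,X],Y) - g(X,[Z,Y]), evaluated on the coordinate vector fields.\<close>

definition lie_derivative_metric ::
  "(real ^ 'n \<Rightarrow> real ^ 'n ^ 'n) \<Rightarrow> (real ^ 'n \<Rightarrow> real ^ 'n) \<Rightarrow> real ^ 'n \<Rightarrow> real ^ 'n ^ 'n::finite" where
  "lie_derivative_metric G Z x = (\<chi> i j.
     frechet_derivative (\<lambda>y. inner_wrt (G y) (coord_field i y) (coord_field j y)) (at x) (Z x)
     - inner_wrt (G x) (lie_bracket Z (coord_field i) x) (coord_field j x)
     - inner_wrt (G x) (coord_field i x) (lie_bracket Z (coord_field j) x))"

lemma lorentz_form_invertible: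
  fixes G :: "real ^ 'n ^ 'n::finite"
  assumes "lorentz_form G"
  shows "invertible G"
proof -
  define E :: "'n \<Rightarrow> real ^ 'n ^ 'n" where
    "E = (\<lambda>i0. \<chi> i j. if i = j then (if i = i0 then - 1 else 1) else 0)"
  obtain P i0 where P: "transpose P ** G ** P = E i0"
    using assms unfolding lorentz_form_def E_def by blast
  have "det (E i0) = (\<Prod>i\<in>UNIV. E i0 $ i $ i)"
    by (rule det_diagonal) (simp add: E_def)
  also have "\<dots> \<noteq> 0"
    by (simp add: E_def)
  finally have "det (transpose P ** G ** P) \<noteq> 0"
    using P by simp
  then show ?thesis
    by (simp add: det_mul invertible_det_nz)
qed

lemma symmetric_entries:
  assumes "transpose H = H"
  shows "H $ a $ b = H $ b $ a"
proof -
  have "transpose H $ a $ b = H $ b $ a"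
    by (simp add: transpose_def)
  then show ?thesis
    by (simp only: assms)
qed

lemma pderiv_at_metric_sym:
  assumes "open S" "x \<in> S" and sym: "\<And>y. y \<in> S \<Longrightarrow> transpose (G y) = G y"
  shows "pderiv_at l (\<lambda>y. G y $ i $ j) x = pderiv_at l (\<lambda>y. G y $ j $ i) x"
proof -
  have eq: "G y $ i $ j = G y $ j $ i" if "y \<in> S" for y
    using sym[OF that] by (rule symmetric_entries)
  have "((\<lambda>y. G y $ i $ j) has_derivative D) (at x) \<longleftrightarrow>
        ((\<lambda>y. G y $ j $ i) has_derivative D) (at x)" for D
    by (rule iffI; erule has_derivative_transform_within_open[OF _ assms(1,2)]) (simp_all only: eq)
  then show ?thesis
    by (simp add: pderiv_at_def frechet_derivative_def)
qed

lemma christoffel_sym: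
  assumes "open S" "x \<in> S" and "\<And>y. y \<in> S \<Longrightarrow> transpose (G y) = G y"
  shows "christoffel G k i j x = christoffel G k j i x"
proof -
  have "pderiv_at l (\<lambda>y. G y $ i $ j) x = pderiv_at l (\<lambda>y. G y $ j $ i) x" for l
    by (rule pderiv_at_metric_sym[OF assms])
  then show ?thesis
    unfolding christoffel_def by (simp only: add.commute)
qed

lemma levi_civita_torsion_free:
  assumes "open S" "x \<in> S" and "\<And>y. y \<in> S \<Longrightarrow> transpose (G y) = G y"
  shows "levi_civita G X Y x - levi_civita G Y X x = lie_bracket X Y x"
proof -
  have "(\<Sum>i\<in>UNIV. \<Sum>j\<in>UNIV. christoffel G k i j x * X x $ i * Y x $ j)
      = (\<Sum>i\<in>UNIV. \<Sum>j\<in>UNIV. christoffel G k i j x * Y x $ i * X x $ j)" for k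
    by (subst sum.swap)
      (intro sum.cong refl, subst christoffel_sym[OF assms], assumption, simp)
  then show ?thesis
    by (simp add: levi_civita_def lie_bracket_def)
qed

lemma christoffel_metric:
  assumes "open S" "x \<in> S" and sym: "\<And>y. y \<in> S \<Longrightarrow> transpose (G y) = G y"
    and inv: "invertible (G x)"
  shows "pderiv_at k (\<lambda>y. G y $ i $ j) x
       = inner_wrt (G x) (levi_civita G (coord_field k) (coord_field i) x) (coord_field j x)
       + inner_wrt (G x) (coord_field i x) (levi_civita G (coord_field k) (coord_field j) x)"
proof -
  have ps: "pderiv_at l (\<lambda>y. G y $ a $ b) x = pderiv_at l (\<lambda>y. G y $ b $ a) x" for l a b
    by (rule pderiv_at_metric_sym[OF assms(1-3)])
  have sx: "G x $ a $ b = G x $ b $ a" for a b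
    using sym[OF assms(2)] by (rule symmetric_entries)
  have lc: "levi_civita G (coord_field k) (coord_field a) x = (\<chi> m. christoffel G m k a x)" for a
  proof -
    have "(\<Sum>i\<in>UNIV. \<Sum>j\<in>UNIV. christoffel G m i j x * axis k 1 $ i * axis a 1 $ j)
        = christoffel G m k a x" for m
      by (simp add: axis_def if_distrib[where f="\<lambda>z. _ * z"] if_distrib[where f="\<lambda>z. z * _"]
          sum.delta cong: if_cong)
    moreover have "frechet_derivative (coord_field a) (at x) = (\<lambda>_. 0)"
      unfolding coord_field_def[abs_def] by simp
    ultimately show ?thesis
      by (simp add: levi_civita_def coord_field_def)
  qed
  have low: "(\<Sum>m\<in>UNIV. christoffel G m k a x * G x $ m $ b)
      = (pderiv_at k (\<lambda>y. G y $ a $ b) x + pderiv_at a (\<lambda>y. G y $ k $ b) x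
         - pderiv_at b (\<lambda>y. G y $ k $ a) x) / 2" for a b
  proof -
    define T where "T l = pderiv_at k (\<lambda>y. G y $ a $ l) x + pderiv_at a (\<lambda>y. G y $ k $ l) x
         - pderiv_at l (\<lambda>y. G y $ k $ a) x" for l
    have one: "(\<Sum>m\<in>UNIV. G x $ b $ m * matrix_inv (G x) $ m $ l) = (if b = l then 1 else 0)" for l
    proof -
      have "G x ** matrix_inv (G x) = mat 1"
        using inv unfolding invertible_def matrix_inv_def by (rule someI2_ex) simp
      then have "(G x ** matrix_inv (G x)) $ b $ l = mat 1 $ b $ l"
        by simp
      then show ?thesis
        by (simp add: matrix_matrix_mult_def mat_def)
    qed
    have "(\<Sum>m\<in>UNIV. christoffel G m k a x * G x $ m $ b)
        = (\<Sum>m\<in>UNIV. \<Sum>l\<in>UNIV. G x $ b $ m * matrix_inv (G x) $ m $ l * T l / 2)"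
      by (simp add: christoffel_def T_def sx[of _ b] sum_distrib_left sum_distrib_right
          sum_divide_distrib mult_ac)
    also have "\<dots> = (\<Sum>l\<in>UNIV. (\<Sum>m\<in>UNIV. G x $ b $ m * matrix_inv (G x) $ m $ l) * T l / 2)"
      by (subst sum.swap) (simp add: sum_distrib_right sum_divide_distrib)
    also have "\<dots> = T b / 2"
      by (simp add: one if_distrib[where f="\<lambda>z. z * _"] if_distrib[where f="\<lambda>z. z / _"]
          sum.delta' cong: if_cong)
    finally show ?thesis
      by (simp add: T_def)
  qed
  have "inner_wrt (G x) v (coord_field b x) = (\<Sum>m\<in>UNIV. v $ m * G x $ m $ b)" for v b
    by (simp add: inner_wrt_def coord_field_def matrix_vector_mult_basis inner_vec_def column_def)
  moreover have "inner_wrt (G x) (coord_field b x) v = (\<Sum>m\<in>UNIV. v $ m * G x $ m $ b)" for v b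
    by (simp add: inner_wrt_def coord_field_def inner_axis' matrix_vector_mult_def
        sx[of b] mult.commute)
  ultimately show ?thesis
    by (simp only: lc low vec_lambda_beta ps[of k j i] ps[of i j k]) (simp add: ps[of j k i] ps[of i k j] field_simps)
qed

text \<open>Tensor equations on M are required in every chart of the atlas at every coordinate point x,
  i.e. at the point \<open>chart_inv c x\<close> of M. The Ricci tensor is required not to be identically zero
  and the two functions a, b not to be both identically zero; this covers in particular the case of
  a nowhere vanishing Ricci tensor.\<close>

definition perfect_fluid_spacetime ::
  "'a topology \<Rightarrow> ('a, 'n::finite) chart set \<Rightarrow> ('a, 'n) tensor2 \<Rightarrow> bool" where
  "perfect_fluid_spacetime M A g \<longleftrightarrow>
     lorentzian_manifold M A g \<and>
     (\<exists>c\<in>A. \<exists>x\<in>coord_range c. ricci (g c) x \<noteq> 0) \<and>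
     (\<exists>a b \<rho>. vector_field A \<rho> \<and>
        \<not> (\<forall>p\<in>topspace M. a p = 0 \<and> b p = 0) \<and>
        (\<forall>c\<in>A. \<forall>x\<in>coord_range c.
           inner_wrt (g c x) (\<rho> c x) (\<rho> c x) = - 1 \<and>
           (let C = (\<lambda>v. inner_wrt (g c x) v (\<rho> c x)) in
            ricci (g c) x = a (chart_inv c x) *\<^sub>R g c x
              + b (chart_inv c x) *\<^sub>R (\<chi> i j. C (axis i 1) * C (axis j 1)))))"

definition k_almost_yamabe_soliton ::
  "('a, 'n::finite) chart set \<Rightarrow> ('a, 'n) tensor2 \<Rightarrow> ('a, 'n) vfield \<Rightarrow> ('a \<Rightarrow> real) \<Rightarrow>
   ('a \<Rightarrow> real) \<Rightarrow> bool" where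
  "k_almost_yamabe_soliton A g Z k l \<longleftrightarrow>
     vector_field A Z \<and> smooth_function A k \<and> smooth_function A l \<and>
     (\<forall>c\<in>A. \<forall>p\<in>fst c. k p \<noteq> 0) \<and>
     (\<forall>c\<in>A. \<forall>x\<in>coord_range c.
        (k (chart_inv c x) / 2) *\<^sub>R lie_derivative_metric (g c) (Z c) x
        = (scalar_curvature (g c) x - l (chart_inv c x)) *\<^sub>R g c x)"

definition killing_field ::
  "('a, 'n::finite) chart set \<Rightarrow> ('a, 'n) tensor2 \<Rightarrow> ('a, 'n) vfield \<Rightarrow> bool" where
  "killing_field A g Z \<longleftrightarrow>
     vector_field A Z \<and> (\<forall>c\<in>A. \<forall>x\<in>coord_range c. lie_derivative_metric (g c) (Z c) x = 0)"

definition divergence_free ::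
  "('a, 'n::finite) chart set \<Rightarrow> ('a, 'n) tensor2 \<Rightarrow> ('a, 'n) vfield \<Rightarrow> bool" where
  "divergence_free A g Z \<longleftrightarrow> (\<forall>c\<in>A. \<forall>x\<in>coord_range c. divergence (g c) (Z c) x = 0)"

end

theory Submission
  imports Defs
begin

text \<open>Since k never vanishes, the soliton equation can be solved pointwise as L_Z g = f g with
  f = 2(R - \<lambda>)/k. Contracting with the inverse metric turns it into 2 div Z = n f, so f, div
  Z and L_Z g vanish together at each point of each chart. The real content is the identity tr(L_Z
  g) = 2 div Z, \<open>trace_lie_derivative_metric\<close>. It compares the coordinate expression of
  L_Z g (\<open>lie_derivative_metric_entry\<close>) with that of div Z
  (\<open>divergence_eq\<close>); the derivatives of the metric match because of the contracted
  Christoffel formula \<open>christoffel_contract\<close>.\<close>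

text \<open>In coordinates the trace of the Lie derivative of the metric along Z is 2 div Z. For a
  soliton the Lie derivative equals f g, whose trace is n f, so div Z = 0 forces f = 0.\<close>

lemma invertible_matrix_inv:
  fixes G :: "real ^ 'n ^ 'n::finite"
  assumes "invertible G"
  shows "G ** matrix_inv G = mat 1" and "matrix_inv G ** G = mat 1"
proof -
  have "G ** matrix_inv G = mat 1 \<and> matrix_inv G ** G = mat 1"
    using assms unfolding invertible_def matrix_inv_def by (rule someI_ex)
  then show "G ** matrix_inv G = mat 1" and "matrix_inv G ** G = mat 1"
    by auto
qed

text \<open>Transposing G G^{-1} = 1 makes the transposed inverse a left inverse of G, and
  cancelling G on the right identifies it with G^{-1}.\<close>

lemma transpose_matrix_inv_symmetric:
  fixes G :: "real ^ 'n ^ 'n::finite"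
  assumes inv: "invertible G" and sym: "transpose G = G"
  shows "transpose (matrix_inv G) = matrix_inv G"
proof -
  have "transpose (matrix_inv G) ** G = mat 1"
    using arg_cong[OF invertible_matrix_inv(1)[OF inv], of transpose]
    by (simp add: matrix_transpose_mul sym)
  then have "transpose (matrix_inv G) ** G ** matrix_inv G = matrix_inv G"
    by simp
  then show ?thesis
    by (simp add: matrix_mul_assoc[symmetric] invertible_matrix_inv(1)[OF inv])
qed

text \<open>Lowering an index with G and raising it again changes nothing, so only the trace of D
  remains. The array D is arbitrary: it will be the derivative of Z, or the Kronecker delta.\<close>

lemma matrix_inv_contract:
  fixes G :: "real ^ 'n ^ 'n::finite"
  assumes inv: "invertible G" and sym: "transpose G = G"
  shows "(\<Sum>i\<in>UNIV. \<Sum>j\<in>UNIV. matrix_inv G $ i $ j * (\<Sum>m\<in>UNIV. D i m * G $ m $ j)) =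
    (\<Sum>i\<in>UNIV. D i i)"
proof (rule sum.cong[OF refl])
  fix i
  have "(\<Sum>j\<in>UNIV. matrix_inv G $ i $ j * (\<Sum>m\<in>UNIV. D i m * G $ m $ j))
      = (\<Sum>m\<in>UNIV. D i m * (\<Sum>j\<in>UNIV. matrix_inv G $ i $ j * G $ m $ j))"
    by (simp only: sum_distrib_left) (subst sum.swap, simp add: mult_ac)
  also have "\<dots> = (\<Sum>m\<in>UNIV. D i m * (matrix_inv G ** G) $ i $ m)"
    by (simp add: matrix_matrix_mult_def symmetric_entries[OF sym, of m for m])
  also have "\<dots> = D i i"
    by (simp add: invertible_matrix_inv(2)[OF inv] mat_def if_distrib[where f="\<lambda>z. _ * z"]
        cong: if_cong)
  finally show "(\<Sum>j\<in>UNIV. matrix_inv G $ i $ j * (\<Sum>m\<in>UNIV. D i m * G $ m $ j)) = D i i" .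
qed

lemma trace_matrix_inv:
  fixes G :: "real ^ 'n ^ 'n::finite"
  assumes "invertible G" and "transpose G = G"
  shows "(\<Sum>i\<in>UNIV. \<Sum>j\<in>UNIV. matrix_inv G $ i $ j * G $ i $ j) = real CARD('n)"
  \<comment> \<open>With D the identity, the trace counts the dimension.\<close>
  using matrix_inv_contract[OF assms, of "\<lambda>i m. of_bool (i = m)"] by simp

lemma frechet_derivative_eq_sum_pderiv_at:
  fixes f :: "real ^ 'n::finite \<Rightarrow> real"
  assumes "f differentiable (at x)"
  shows "frechet_derivative f (at x) v = (\<Sum>m\<in>UNIV. v $ m * pderiv_at m f x)"
proof -
  interpret linear "frechet_derivative f (at x)"
    using assms by (rule linear_frechet_derivative)
  have "frechet_derivative f (at x) v = frechet_derivative f (at x) (\<Sum>m\<in>UNIV. v $ m *\<^sub>R axis m 1)"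
    using basis_expansion[of v] by (simp add: scalar_mult_eq_scaleR)
  also have "\<dots> = (\<Sum>m\<in>UNIV. v $ m * pderiv_at m f x)"
    by (simp add: sum scale pderiv_at_def)
  finally show ?thesis .
qed

lemma inner_wrt_axis: "inner_wrt G (axis i 1) (axis j 1) = G $ i $ j"
  by (simp add: inner_wrt_def inner_axis' matrix_vector_mult_basis column_def)

lemma inner_wrt_axis_left: "inner_wrt G (axis i 1) v = (\<Sum>m\<in>UNIV. G $ i $ m * v $ m)"
  by (simp add: inner_wrt_def inner_axis' matrix_vector_mult_def)

lemma inner_wrt_axis_right: "inner_wrt G v (axis j 1) = (\<Sum>m\<in>UNIV. v $ m * G $ m $ j)"
  by (simp add: inner_wrt_def matrix_vector_mult_basis column_def inner_vec_def)


text \<open>Coordinate fields are constant, so [Z, e_i] is minus the i-th partial derivative of Z,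
  and the minus signs in the definition become plus signs. Differentiability of G allows the
  derivative along Z to be expanded in partial derivatives.\<close>

lemma lie_derivative_metric_entry:
  assumes "G differentiable (at x)" and sym: "transpose (G x) = G x"
  shows "lie_derivative_metric G Z x $ i $ j =
    (\<Sum>m\<in>UNIV. Z x $ m * pderiv_at m (\<lambda>y. G y $ i $ j) x)
    + (\<Sum>m\<in>UNIV. frechet_derivative Z (at x) (axis i 1) $ m * G x $ m $ j)
    + (\<Sum>m\<in>UNIV. frechet_derivative Z (at x) (axis j 1) $ m * G x $ m $ i)"
proof -
  obtain D where "(G has_derivative D) (at x)"
    using assms(1) unfolding differentiable_def by blast
  then have "((\<lambda>y. G y $ i $ j) has_derivative (\<lambda>v. D v $ i $ j)) (at x)"
    by (intro bounded_linear.has_derivative[OF bounded_linear_vec_nth])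
  then have "(\<lambda>y. G y $ i $ j) differentiable (at x)"
    by (rule differentiableI)
  then show ?thesis
    by (simp add: lie_derivative_metric_def lie_bracket_def coord_field_def[abs_def] inner_wrt_axis
        inner_wrt_axis_left[where v = "- w" for w] inner_wrt_axis_right[where v = "- w" for w]
        frechet_derivative_eq_sum_pderiv_at sum_negf
        symmetric_entries[OF sym, of i] mult.commute)
qed

text \<open>Of the three derivatives of the metric in the Christoffel symbol, two cancel under the
  trace because the inverse metric is symmetric. The result is the partial derivative of log sqrt
  |det G|.\<close>

lemma christoffel_contract:
  assumes "open S" "x \<in> S" and sym: "\<And>y. y \<in> S \<Longrightarrow> transpose (G y) = G y"
    and inv: "invertible (G x)"
  shows "(\<Sum>i\<in>UNIV. christoffel G i i m x) =
    (\<Sum>i\<in>UNIV. \<Sum>j\<in>UNIV. matrix_inv (G x) $ i $ j * pderiv_at m (\<lambda>y. G y $ i $ j) x) / 2"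
proof -
  let ?H = "matrix_inv (G x)"
  let ?P = "\<lambda>l i j. pderiv_at l (\<lambda>y. G y $ i $ j) x"
  have Hs: "?H $ i $ j = ?H $ j $ i" for i j
    using transpose_matrix_inv_symmetric[OF inv sym[OF assms(2)]] by (rule symmetric_entries)
  have Ps: "?P l i j = ?P l j i" for l i j
    by (rule pderiv_at_metric_sym[OF assms(1-3)])
  \<comment> \<open>Exchanging the names i and l carries the negative term into the first positive
    one.\<close>
  have "(\<Sum>i\<in>UNIV. \<Sum>l\<in>UNIV. ?H $ i $ l * ?P l i m) = (\<Sum>i\<in>UNIV. \<Sum>l\<in>UNIV. ?H $ l $ i * ?P i l m)"
    by (rule sum.swap)
  also have "\<dots> = (\<Sum>i\<in>UNIV. \<Sum>l\<in>UNIV. ?H $ i $ l * ?P i m l)"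
    by (simp only: Hs Ps[of _ m])
  finally have "(\<Sum>i\<in>UNIV. \<Sum>l\<in>UNIV. ?H $ i $ l * (?P i m l + ?P m i l - ?P l i m))
      = (\<Sum>i\<in>UNIV. \<Sum>l\<in>UNIV. ?H $ i $ l * ?P m i l)"
    by (simp add: ring_distribs sum.distrib sum_subtractf)
  then show ?thesis
    by (simp add: christoffel_def sum_divide_distrib[symmetric])
qed

lemma divergence_eq:
  "divergence G Z x = (\<Sum>i\<in>UNIV. frechet_derivative Z (at x) (axis i 1) $ i)
    + (\<Sum>m\<in>UNIV. Z x $ m * (\<Sum>i\<in>UNIV. christoffel G i i m x))"
proof -
  have "(\<Sum>a\<in>UNIV. \<Sum>m\<in>UNIV. christoffel G i a m x * axis i 1 $ a * Z x $ m)
      = (\<Sum>m\<in>UNIV. christoffel G i i m x * Z x $ m)" for i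
    by (subst sum.swap) (simp add: axis_def if_distrib[where f="\<lambda>z. _ * z"]
        if_distrib[where f="\<lambda>z. z * _"] cong: if_cong)
  then have "divergence G Z x = (\<Sum>i\<in>UNIV. frechet_derivative Z (at x) (axis i 1) $ i)
    + (\<Sum>i\<in>UNIV. \<Sum>m\<in>UNIV. christoffel G i i m x * Z x $ m)"
    by (simp add: divergence_def levi_civita_def coord_field_def sum.distrib)
  also have "(\<Sum>i\<in>UNIV. \<Sum>m\<in>UNIV. christoffel G i i m x * Z x $ m)
      = (\<Sum>m\<in>UNIV. Z x $ m * (\<Sum>i\<in>UNIV. christoffel G i i m x))"
    by (subst sum.swap) (simp add: sum_distrib_left mult.commute)
  finally show ?thesis .
qed

text \<open>Each of the two terms with derivatives of Z contracts to the sum of \<partial>_i Z^i,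
  and the term with derivatives of G contracts to twice the Christoffel part of div Z.\<close>

lemma trace_lie_derivative_metric:
  assumes "open S" "x \<in> S" and sym: "\<And>y. y \<in> S \<Longrightarrow> transpose (G y) = G y"
    and inv: "invertible (G x)" and diff: "G differentiable (at x)"
  shows "(\<Sum>i\<in>UNIV. \<Sum>j\<in>UNIV. matrix_inv (G x) $ i $ j * lie_derivative_metric G Z x $ i $ j)
    = 2 * divergence G Z x"
proof -
  let ?H = "matrix_inv (G x)"
  let ?D = "\<lambda>i m. frechet_derivative Z (at x) (axis i 1) $ m"
  let ?P = "\<lambda>l i j. pderiv_at l (\<lambda>y. G y $ i $ j) x"
  note symx = sym[OF assms(2)]
  have Hs: "?H $ i $ j = ?H $ j $ i" for i j
    using transpose_matrix_inv_symmetric[OF inv symx] by (rule symmetric_entries)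
  have 1: "(\<Sum>i\<in>UNIV. \<Sum>j\<in>UNIV. ?H $ i $ j * (\<Sum>m\<in>UNIV. ?D i m * G x $ m $ j)) = (\<Sum>i\<in>UNIV. ?D i i)"
    by (rule matrix_inv_contract[OF inv symx])
  have 2: "(\<Sum>i\<in>UNIV. \<Sum>j\<in>UNIV. ?H $ i $ j * (\<Sum>m\<in>UNIV. ?D j m * G x $ m $ i)) = (\<Sum>i\<in>UNIV. ?D i i)"
    by (subst sum.swap, subst Hs) (rule 1)
  have "(\<Sum>i\<in>UNIV. \<Sum>j\<in>UNIV. ?H $ i $ j * (\<Sum>m\<in>UNIV. Z x $ m * ?P m i j))
      = (\<Sum>i\<in>UNIV. \<Sum>m\<in>UNIV. \<Sum>j\<in>UNIV. ?H $ i $ j * (Z x $ m * ?P m i j))"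
    by (subst sum.swap) (simp add: sum_distrib_left)
  also have "\<dots> = (\<Sum>m\<in>UNIV. Z x $ m * (\<Sum>i\<in>UNIV. \<Sum>j\<in>UNIV. ?H $ i $ j * ?P m i j))"
    by (subst sum.swap) (simp add: sum_distrib_left mult_ac)
  also have "\<dots> = 2 * (\<Sum>m\<in>UNIV. Z x $ m * (\<Sum>i\<in>UNIV. christoffel G i i m x))"
    by (simp add: christoffel_contract[where G = G and S = S, OF assms(1,2) sym inv]
        sum_divide_distrib[symmetric])
  finally show ?thesis
    by (simp add: lie_derivative_metric_entry[OF diff symx] divergence_eq distrib_left
        sum.distrib 1 2)
qed

theorem theorem1p1:
  fixes M :: "'a topology" and A :: "('a, 'n::finite) chart set"
    and g :: "('a, 'n) tensor2" and Z :: "('a, 'n) vfield" and k l :: "'a \<Rightarrow> real"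
  assumes "CARD('n) \<ge> 3"
    and "perfect_fluid_spacetime M A g"
    and "k_almost_yamabe_soliton A g Z k l"
  shows "killing_field A g Z \<longleftrightarrow> divergence_free A g Z"
proof -
  have lm: "lorentzian_manifold M A g"
    using assms(2) by (simp add: perfect_fluid_spacetime_def)
  \<comment> \<open>Both properties are pointwise conditions in charts, so it suffices to compare
    them at one coordinate point.\<close>
  have "lie_derivative_metric (g c) (Z c) x = 0 \<longleftrightarrow> divergence (g c) (Z c) x = 0"
    if c: "c \<in> A" and x: "x \<in> coord_range c" for c x
  proof -
    have op: "open (coord_range c)"
      using lm c by (auto simp: lorentzian_manifold_def smooth_manifold_def is_chart_def)
    have lf: "lorentz_form (g c y)" if "y \<in> coord_range c" for y
      using lm c that by (auto simp: lorentzian_manifold_def)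
    then have sym: "transpose (g c y) = g c y" if "y \<in> coord_range c" for y
      using that by (simp add: lorentz_form_def)
    have inv: "invertible (g c x)"
      by (rule lorentz_form_invertible[OF lf[OF x]])
    have "Ck_on (Suc 0) (g c) (coord_range c)"
      using lm c unfolding lorentzian_manifold_def covariant_2_tensor_def smooth_map_on_def by blast
    then have diff: "g c differentiable (at x)"
      using x by simp
    note tr = trace_lie_derivative_metric[OF op x sym inv diff, of "Z c"]
    define p where "p = chart_inv c x"
    have "p \<in> fst c"
      using x by (simp add: p_def chart_inv_def coord_range_def inv_into_into)
    then have k: "k p \<noteq> 0"
      using assms(3) c by (auto simp: k_almost_yamabe_soliton_def)
    define f where "f = 2 * (scalar_curvature (g c) x - l p) / k p"
    have "(k p / 2) *\<^sub>R lie_derivative_metric (g c) (Z c) x = (scalar_curvature (g c) x - l p) *\<^sub>R g c x"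
      using assms(3) c x by (simp add: k_almost_yamabe_soliton_def p_def)
    then have "(2 / k p) *\<^sub>R (k p / 2) *\<^sub>R lie_derivative_metric (g c) (Z c) x = f *\<^sub>R g c x"
      by (simp add: f_def)
    then have L: "lie_derivative_metric (g c) (Z c) x = f *\<^sub>R g c x"
      using k by simp
    have "2 * divergence (g c) (Z c) x
        = f * (\<Sum>i\<in>UNIV. \<Sum>j\<in>UNIV. matrix_inv (g c x) $ i $ j * g c x $ i $ j)"
      by (simp add: tr[symmetric] L sum_distrib_left mult_ac)
    then have "2 * divergence (g c) (Z c) x = f * real CARD('n)"
      by (simp only: trace_matrix_inv[OF inv sym[OF x]])
    \<comment> \<open>Here 0 = f n with n = CARD('n) positive, hence f = 0.\<close>
    moreover have "lie_derivative_metric (g c) (Z c) x = 0" if "divergence (g c) (Z c) x = 0"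
      using calculation that by (simp add: L)
    moreover have "divergence (g c) (Z c) x = 0" if "lie_derivative_metric (g c) (Z c) x = 0"
      using tr that by simp
    ultimately show ?thesis
      by blast
  qed
  moreover have "vector_field A Z"
    using assms(3) by (simp add: k_almost_yamabe_soliton_def)
  ultimately show ?thesis
    by (auto simp: killing_field_def divergence_free_def)
qed

end
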